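(* The lattice $\mathcal{L}(\mathsf{V}(B_0))$ of subvarieties of $\mathsf V(B_0)$ is infinite. More precisely, it contains the infinite strictly ascending chain $$\mathsf{V}(S(a_1)) \subsetneq \mathsf{V}(S(a_1a_2)) \subsetneq \mathsf{V}(S(a_1a_2a_3))\subsetneq \cdots,$$ where $a_1,a_2,a_3,\dots$ are distinct letters.
   Context: A semiring is an algebra $(S,+,\cdot)$ with two binary operations (no constants in the signature) such that $(S,+)$ is a commutative semigroup, $(S,\cdot)$ is a semigroup, and both distributive laws hold. $\mathsf V(S)$ is the variety (class closed under subalgebras, homomorphic images and arbitrary direct products) generated by $S$, and $\mathcal L(\mathcal V)$ is the lattice of all subvarieties of $\mathcal V$ under inclusion. $B_0$ is the semiring on $\{0,e_{11},e_{12},e_{22}\}$, where $0$ is the $2\times2$ zero matrix and $e_{ij}$ the $2\times 2$ matrix units; multiplication is matrix multiplication, and addition is flat: $x+x=x$ and $x+y=0$ whenever $x\neq y$. $S(a_1\cdots a_n)$ is the flat semiring whose elements are $0$ and all nonempty (contiguous) subwords $a_ia_{i+1}\cdots a_j$ ($1\le i\le j\le n$) of the word $a_1\cdots a_n$ in the free semigroup. Multiplication: $\mathbf u\cdot\mathbf v$ is the concatenation $\mathbf u\mathbf v$ if it is again a subword of $a_1\cdots a_n$, and $0$ otherwise; $0$ is a multiplicative zero. Addition: $x+x=x$ and $x+y=0$ whenever $x\ne y$. *)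

theory Defs
  imports "HOL-Analysis.Finite_Cartesian_Product" "HOL-Library.Sublist"
begin

text \<open>Semirings in the signature of two binary operations, with explicit non-empty carrier.
  The values of the operations outside the carrier are irrelevant.\<close>

record 'a alg =
  carrier :: "'a set"
  plus_of :: "'a \<Rightarrow> 'a \<Rightarrow> 'a"
  times_of :: "'a \<Rightarrow> 'a \<Rightarrow> 'a"

definition is_semiring :: "'a alg \<Rightarrow> bool" where
  "is_semiring S \<longleftrightarrow>
     carrier S \<noteq> {} \<and>
     (\<forall>x\<in>carrier S. \<forall>y\<in>carrier S. plus_of S x y \<in> carrier S) \<and>
     (\<forall>x\<in>carrier S. \<forall>y\<in>carrier S. times_of S x y \<in> carrier S) \<and>
     (\<forall>x\<in>carrier S. \<forall>y\<in>carrier S. plus_of S x y = plus_of S y x) \<and>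
     (\<forall>x\<in>carrier S. \<forall>y\<in>carrier S. \<forall>z\<in>carrier S.
        plus_of S (plus_of S x y) z = plus_of S x (plus_of S y z)) \<and>
     (\<forall>x\<in>carrier S. \<forall>y\<in>carrier S. \<forall>z\<in>carrier S.
        times_of S (times_of S x y) z = times_of S x (times_of S y z)) \<and>
     (\<forall>x\<in>carrier S. \<forall>y\<in>carrier S. \<forall>z\<in>carrier S.
        times_of S x (plus_of S y z) = plus_of S (times_of S x y) (times_of S x z)) \<and>
     (\<forall>x\<in>carrier S. \<forall>y\<in>carrier S. \<forall>z\<in>carrier S.
        times_of S (plus_of S x y) z = plus_of S (times_of S x z) (times_of S y z))"

definition is_subalg :: "'a alg \<Rightarrow> 'a alg \<Rightarrow> bool" where
  "is_subalg B A \<longleftrightarrow>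
     carrier B \<noteq> {} \<and> carrier B \<subseteq> carrier A \<and>
     (\<forall>x\<in>carrier B. \<forall>y\<in>carrier B.
        plus_of B x y \<in> carrier B \<and> plus_of B x y = plus_of A x y \<and>
        times_of B x y \<in> carrier B \<and> times_of B x y = times_of A x y)"

definition is_epi :: "('a \<Rightarrow> 'b) \<Rightarrow> 'a alg \<Rightarrow> 'b alg \<Rightarrow> bool" where
  "is_epi f A B \<longleftrightarrow>
     f ` carrier A = carrier B \<and>
     (\<forall>x\<in>carrier A. \<forall>y\<in>carrier A.
        f (plus_of A x y) = plus_of B (f x) (f y) \<and>
        f (times_of A x y) = times_of B (f x) (f y))"

definition isomorphic :: "'a alg \<Rightarrow> 'b alg \<Rightarrow> bool" where
  "isomorphic A B \<longleftrightarrow> (\<exists>f. is_epi f A B \<and> inj_on f (carrier A))"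

definition prod_alg :: "'i set \<Rightarrow> ('i \<Rightarrow> 'a alg) \<Rightarrow> ('i \<Rightarrow> 'a) alg" where
  "prod_alg I A =
     \<lparr>carrier = PiE I (\<lambda>i. carrier (A i)),
      plus_of = (\<lambda>x y. \<lambda>i\<in>I. plus_of (A i) (x i) (y i)),
      times_of = (\<lambda>x y. \<lambda>i\<in>I. times_of (A i) (x i) (y i))\<rparr>"

text \<open>A class of semirings is represented by its members with carrier in a type \<open>'u\<close>
  (the universe); theorems are stated for every infinite \<open>'u\<close>, so members of arbitrary
  cardinality are covered.

  An infinite product of members need not fit into \<open>'u\<close>, so closure under products is closure
  under those subalgebras of products that have an isomorphic copy in \<open>'u\<close>; this includes the
  products themselves when they fit. (Closure under just those products that fit would be too
  weak: for countable \<open>'u\<close> it amounts essentially to finite products.) Indexing families by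
  subsets of \<open>'u\<close> is no restriction: for infinite \<open>'u\<close>, at most \<open>|'u \<times> 'u| = |'u|\<close> coordinates
  of a product are needed to separate the points of a subalgebra that has a copy in \<open>'u\<close>.
  A variety of semirings is determined by its countable members, so for infinite \<open>'u\<close> the
  varieties below correspond exactly, and preserving inclusion, to the varieties of all
  semirings.\<close>

definition is_variety :: "'u alg set \<Rightarrow> bool" where
  "is_variety K \<longleftrightarrow>
     (\<forall>A\<in>K. is_semiring A) \<and>
     (\<forall>A\<in>K. \<forall>B. is_subalg B A \<longrightarrow> B \<in> K) \<and>
     (\<forall>A\<in>K. \<forall>B f. is_epi f A B \<longrightarrow> B \<in> K) \<and>
     (\<forall>(I :: 'u set) A P B.
        (\<forall>i\<in>I. A i \<in> K) \<and> is_subalg P (prod_alg I A) \<and> isomorphic P B \<longrightarrow> B \<in> K)"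

text \<open>The generator may live in a type other than the universe, hence the isomorphic copies
  of it.\<close>

definition V :: "'a alg \<Rightarrow> 'u alg set" where
  "V S = \<Inter> {K. is_variety K \<and> (\<forall>T. isomorphic S T \<longrightarrow> T \<in> K)}"

text \<open>The subvariety lattice; its order is inclusion.\<close>

definition subvarieties :: "'u alg set \<Rightarrow> 'u alg set set" where
  "subvarieties K = {W. is_variety W \<and> W \<subseteq> K}"

definition flat_add :: "'a \<Rightarrow> 'a \<Rightarrow> 'a \<Rightarrow> 'a" where
  "flat_add z x y = (if x = y then x else z)"

definition matrix_unit :: "2 \<Rightarrow> 2 \<Rightarrow> int ^ 2 ^ 2" where
  "matrix_unit i j = (\<chi> r c. if r = i \<and> c = j then 1 else 0)"

definition B0 :: "(int ^ 2 ^ 2) alg" where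
  "B0 = \<lparr>carrier = {0, matrix_unit 1 1, matrix_unit 1 2, matrix_unit 2 2},
         plus_of = flat_add 0,
         times_of = (**)\<rparr>"

text \<open>\<open>None\<close> is the zero; \<open>sublist\<close> means contiguous subword.\<close>

fun word_mult :: "'a list \<Rightarrow> 'a list option \<Rightarrow> 'a list option \<Rightarrow> 'a list option" where
  "word_mult w (Some u) (Some v) = (if sublist (u @ v) w then Some (u @ v) else None)"
| "word_mult w _ _ = None"

definition word_semiring :: "'a list \<Rightarrow> 'a list option alg" where
  "word_semiring w =
     \<lparr>carrier = insert None (Some ` {u. u \<noteq> [] \<and> sublist u w}),
      plus_of = flat_add None,
      times_of = word_mult w\<rparr>"

lemma is_semiringI:
  assumes "carrier S \<noteq> {}"
    and "\<And>x y. x \<in> carrier S \<Longrightarrow> y \<in> carrier S \<Longrightarrow> plus_of S x y \<in> carrier S"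
    and "\<And>x y. x \<in> carrier S \<Longrightarrow> y \<in> carrier S \<Longrightarrow> times_of S x y \<in> carrier S"
    and "\<And>x y. x \<in> carrier S \<Longrightarrow> y \<in> carrier S \<Longrightarrow> plus_of S x y = plus_of S y x"
    and "\<And>x y z. x \<in> carrier S \<Longrightarrow> y \<in> carrier S \<Longrightarrow> z \<in> carrier S \<Longrightarrow>
      plus_of S (plus_of S x y) z = plus_of S x (plus_of S y z)"
    and "\<And>x y z. x \<in> carrier S \<Longrightarrow> y \<in> carrier S \<Longrightarrow> z \<in> carrier S \<Longrightarrow>
      times_of S (times_of S x y) z = times_of S x (times_of S y z)"
    and "\<And>x y z. x \<in> carrier S \<Longrightarrow> y \<in> carrier S \<Longrightarrow> z \<in> carrier S \<Longrightarrow>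
      times_of S x (plus_of S y z) = plus_of S (times_of S x y) (times_of S x z)"
    and "\<And>x y z. x \<in> carrier S \<Longrightarrow> y \<in> carrier S \<Longrightarrow> z \<in> carrier S \<Longrightarrow>
      times_of S (plus_of S x y) z = plus_of S (times_of S x z) (times_of S y z)"
  shows "is_semiring S"
  unfolding is_semiring_def by (intro conjI ballI; fact assms)

lemma is_semiringD:
  assumes "is_semiring S"
  shows "carrier S \<noteq> {}"
    and "x \<in> carrier S \<Longrightarrow> y \<in> carrier S \<Longrightarrow> plus_of S x y \<in> carrier S"
    and "x \<in> carrier S \<Longrightarrow> y \<in> carrier S \<Longrightarrow> times_of S x y \<in> carrier S"
    and "x \<in> carrier S \<Longrightarrow> y \<in> carrier S \<Longrightarrow> plus_of S x y = plus_of S y x"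
    and "x \<in> carrier S \<Longrightarrow> y \<in> carrier S \<Longrightarrow> z \<in> carrier S \<Longrightarrow>
      plus_of S (plus_of S x y) z = plus_of S x (plus_of S y z)"
    and "x \<in> carrier S \<Longrightarrow> y \<in> carrier S \<Longrightarrow> z \<in> carrier S \<Longrightarrow>
      times_of S (times_of S x y) z = times_of S x (times_of S y z)"
    and "x \<in> carrier S \<Longrightarrow> y \<in> carrier S \<Longrightarrow> z \<in> carrier S \<Longrightarrow>
      times_of S x (plus_of S y z) = plus_of S (times_of S x y) (times_of S x z)"
    and "x \<in> carrier S \<Longrightarrow> y \<in> carrier S \<Longrightarrow> z \<in> carrier S \<Longrightarrow>
      times_of S (plus_of S x y) z = plus_of S (times_of S x z) (times_of S y z)"
  using assms unfolding is_semiring_def by blast+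

lemma is_semiring_epi:
  assumes A: "is_semiring A" and f: "is_epi f A B"
  shows "is_semiring B"
proof -
  have B: "carrier B = f ` carrier A" using f by (simp add: is_epi_def)
  have f': "plus_of B (f x) (f y) = f (plus_of A x y)"
    "times_of B (f x) (f y) = f (times_of A x y)" if "x \<in> carrier A" "y \<in> carrier A" for x y
    using f that by (simp_all add: is_epi_def)
  note D = is_semiringD[OF A]
  have "f (plus_of A x y) = f (plus_of A y x)" if "x \<in> carrier A" "y \<in> carrier A" for x y
    using D(4) that by metis
  then show ?thesis
    by (intro is_semiringI) (auto simp: B f' D(1-3,5-8))
qed

lemma is_semiring_subalg:
  assumes A: "is_semiring A" and sub: "is_subalg B A"
  shows "is_semiring B"
proof -
  have B: "carrier B \<noteq> {}" "\<And>x. x \<in> carrier B \<Longrightarrow> x \<in> carrier A"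
    using sub by (auto simp: is_subalg_def)
  have op: "plus_of B x y = plus_of A x y" "times_of B x y = times_of A x y"
    and cl: "plus_of A x y \<in> carrier B" "times_of A x y \<in> carrier B"
    if "x \<in> carrier B" "y \<in> carrier B" for x y
    using sub that unfolding is_subalg_def by metis+
  note D = is_semiringD[OF A]
  show ?thesis
  proof (rule is_semiringI)
    show "plus_of B x y = plus_of B y x" if "x \<in> carrier B" "y \<in> carrier B" for x y
      unfolding op[OF that] op[OF that(2,1)] by (intro D(4) B(2) that)
  qed (simp_all add: op cl B D(5-8))
qed

lemma is_semiring_prod:
  assumes A: "\<And>i. i \<in> I \<Longrightarrow> is_semiring (A i)"
  shows "is_semiring (prod_alg I A)"
proof -
  note D = is_semiringD[OF A]
  show ?thesis
  proof (rule is_semiringI)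
    show "carrier (prod_alg I A) \<noteq> {}"
      by (simp add: prod_alg_def PiE_eq_empty_iff D(1))
  next
    fix x y assume "x \<in> carrier (prod_alg I A)" "y \<in> carrier (prod_alg I A)"
    then have xy: "x i \<in> carrier (A i)" "y i \<in> carrier (A i)" if "i \<in> I" for i
      using that by (auto simp: prod_alg_def)
    show "plus_of (prod_alg I A) x y \<in> carrier (prod_alg I A)"
      "times_of (prod_alg I A) x y \<in> carrier (prod_alg I A)"
      by (simp_all add: prod_alg_def xy D(2,3))
    show "plus_of (prod_alg I A) x y = plus_of (prod_alg I A) y x"
      by (simp add: prod_alg_def) (intro restrict_ext D(4) xy)
  next
    fix x y z
    assume "x \<in> carrier (prod_alg I A)" "y \<in> carrier (prod_alg I A)" "z \<in> carrier (prod_alg I A)"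
    then have xyz: "x i \<in> carrier (A i)" "y i \<in> carrier (A i)" "z i \<in> carrier (A i)"
      if "i \<in> I" for i
      using that by (auto simp: prod_alg_def)
    let ?plus = "plus_of (prod_alg I A)" and ?times = "times_of (prod_alg I A)"
    show "?plus (?plus x y) z = ?plus x (?plus y z)"
      "?times (?times x y) z = ?times x (?times y z)"
      "?times x (?plus y z) = ?plus (?times x y) (?times x z)"
      "?times (?plus x y) z = ?plus (?times x z) (?times y z)"
      by (simp_all add: prod_alg_def fun_eq_iff restrict_def xyz D(5-8))
  qed
qed

lemma is_variety_semirings: "is_variety {A :: 'a alg. is_semiring A}"
  unfolding is_variety_def
proof (intro conjI ballI allI impI)
  fix I :: "'a set" and A and P :: "('a \<Rightarrow> 'a) alg" and B :: "'a alg"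
  assume *: "(\<forall>i\<in>I. A i \<in> {A. is_semiring A}) \<and> is_subalg P (prod_alg I A) \<and> isomorphic P B"
  then have "is_semiring (prod_alg I A)" by (auto intro: is_semiring_prod)
  with * have "is_semiring P" by (auto intro: is_semiring_subalg)
  with * show "B \<in> {A. is_semiring A}" by (auto simp: isomorphic_def intro: is_semiring_epi)
qed (auto intro: is_semiring_epi is_semiring_subalg)

lemma is_variety_Inter:
  fixes \<K> :: "'a alg set set"
  assumes "\<K> \<noteq> {}" "\<And>K. K \<in> \<K> \<Longrightarrow> is_variety K"
  shows "is_variety (\<Inter>\<K>)"
  unfolding is_variety_def
proof (intro conjI ballI allI impI)
  fix A assume "A \<in> \<Inter>\<K>"
  then show "is_semiring A" using assms unfolding is_variety_def by blast
next
  fix A B :: "'a alg" assume "A \<in> \<Inter>\<K>" "is_subalg B A"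
  then show "B \<in> \<Inter>\<K>" using assms unfolding is_variety_def by blast
next
  fix A B :: "'a alg" and f :: "'a \<Rightarrow> 'a" assume "A \<in> \<Inter>\<K>" "is_epi f A B"
  then show "B \<in> \<Inter>\<K>" using assms unfolding is_variety_def by blast
next
  fix I :: "'a set" and A and P :: "('a \<Rightarrow> 'a) alg" and B :: "'a alg"
  assume *: "(\<forall>i\<in>I. A i \<in> \<Inter>\<K>) \<and> is_subalg P (prod_alg I A) \<and> isomorphic P B"
  show "B \<in> \<Inter>\<K>"
  proof
    fix K assume K: "K \<in> \<K>"
    then have "\<forall>i\<in>I. A i \<in> K" using * by blast
    then show "B \<in> K" using * assms(2)[OF K] unfolding is_variety_def by blast
  qed
qed

lemma is_variety_V:
  assumes "is_semiring S"
  shows "is_variety (V S)"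
  unfolding V_def
proof (rule is_variety_Inter)
  have "is_variety {A. is_semiring A} \<and> (\<forall>T. isomorphic S T \<longrightarrow> T \<in> {A. is_semiring A})"
    using is_variety_semirings is_semiring_epi[OF assms] unfolding isomorphic_def by blast
  then show "{K. is_variety K \<and> (\<forall>T. isomorphic S T \<longrightarrow> T \<in> K)} \<noteq> {}" by blast
qed blast

lemma matrix_unit_mult:
  "matrix_unit i j ** matrix_unit k l = (if j = k then matrix_unit i l else 0)"
proof -
  have "(\<Sum>t\<in>UNIV. matrix_unit i j $ r $ t * matrix_unit k l $ t $ c) =
    (\<Sum>t\<in>UNIV. if t = j then if r = i \<and> j = k \<and> c = l then 1 else 0 else 0)" for r c
    by (rule sum.cong) (auto simp: matrix_unit_def)
  then show ?thesis
    by (simp add: matrix_matrix_mult_def vec_eq_iff) (simp add: matrix_unit_def)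
qed

lemma matrix_unit_nth: "matrix_unit i j $ r $ c = (if r = i \<and> c = j then 1 else 0)"
  by (simp add: matrix_unit_def)

lemma matrix_unit_eq_iff [simp]: "matrix_unit i j = matrix_unit k l \<longleftrightarrow> i = k \<and> j = l"
proof
  assume "matrix_unit i j = matrix_unit k l"
  then have "matrix_unit i j $ i $ j = matrix_unit k l $ i $ j" by simp
  then show "i = k \<and> j = l" by (simp add: matrix_unit_nth split: if_splits)
qed simp

lemma matrix_unit_neq_0 [simp]: "matrix_unit i j \<noteq> 0" "0 \<noteq> matrix_unit i j"
proof -
  have "matrix_unit i j $ i $ j \<noteq> 0 $ i $ j" by (simp add: matrix_unit_nth)
  then show "matrix_unit i j \<noteq> 0" by metis
  then show "0 \<noteq> matrix_unit i j" by simp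
qed

lemma is_semiring_B0: "is_semiring B0"
  unfolding is_semiring_def B0_def
  by (auto simp: flat_add_def matrix_unit_mult)

lemma is_semiring_word_semiring: "is_semiring (word_semiring w)"
proof -
  have l: "sublist u w" and r: "sublist v w" if "sublist (u @ v) w" for u v
    using that unfolding sublist_def by (metis append_assoc)+
  have "word_mult w (word_mult w (Some a) (Some b)) (Some c) =
      word_mult w (Some a) (word_mult w (Some b) (Some c))" for a b c
    using l[of "a @ b" c] r[of a "b @ c"] by simp
  moreover have "word_mult w x None = None" for x by (cases x) auto
  ultimately have "word_mult w (word_mult w x y) z = word_mult w x (word_mult w y z)" for x y z
    by (cases x; cases y; cases z) (simp_all only: word_mult.simps(2,3))
  moreover have "word_mult w x (flat_add None y z) = flat_add None (word_mult w x y) (word_mult w x z)"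
    for x y z by (cases x; cases y; cases z) (auto simp: flat_add_def)
  moreover have "word_mult w (flat_add None x y) z = flat_add None (word_mult w x z) (word_mult w y z)"
    for x y z by (cases x; cases y; cases z) (auto simp: flat_add_def)
  moreover have "word_mult w x y \<in> insert None (Some ` {u. u \<noteq> [] \<and> sublist u w})"
    if "x \<in> insert None (Some ` {u. u \<noteq> [] \<and> sublist u w})" for x y
    using that by (cases x; cases y) auto
  ultimately show ?thesis
    unfolding is_semiring_def word_semiring_def by (auto simp: flat_add_def)
qed

end

(* Both operations of a flat algebra detect difference by producing 0.  So S(a_1 ... a_n) is a
   quotient of a subalgebra of the n-th power of B0: give the subword a_j ... a_k the vector with
   entry e22 left of position j, e12 between j and k, and e11 right of k.  Two such vectors have a
   product without zero entries exactly if the subwords are adjacent, and all vectors with a zero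
   entry can be collapsed.  The varieties are told apart by nilpotency: all products of n + 1
   elements agree in S(a_1 ... a_n), but not in S(a_1 ... a_{n+1}). *)

theory Submission
  imports Defs
begin

section \<open>Homomorphisms and isomorphic copies\<close>

lemma is_epi_comp:
  assumes f: "is_epi f A B" and g: "is_epi g B C"
  shows "is_epi (g \<circ> f) A C"
proof -
  have B: "carrier B = f ` carrier A" using f by (simp add: is_epi_def)
  have "(g \<circ> f) ` carrier A = carrier C" using g by (simp add: is_epi_def B image_comp)
  then show ?thesis using f g unfolding is_epi_def B by simp
qed

lemma isomorphic_trans:
  assumes "isomorphic A B" "isomorphic B C"
  shows "isomorphic A C"
proof -
  obtain f g where f: "is_epi f A B" "inj_on f (carrier A)"
    and g: "is_epi g B C" "inj_on g (carrier B)"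
    using assms unfolding isomorphic_def by blast
  moreover have "f ` carrier A = carrier B" using f by (simp add: is_epi_def)
  ultimately show ?thesis
    unfolding isomorphic_def by (metis is_epi_comp comp_inj_on)
qed

text \<open>\<^term>\<open>is_subalg A A\<close> expresses that \<^term>\<open>A\<close> is non-empty and closed under its operations.\<close>

lemma is_subalg_self: "is_subalg P A \<Longrightarrow> is_subalg P P"
  unfolding is_subalg_def by blast

lemma is_semiring_imp_is_subalg_self: "is_semiring A \<Longrightarrow> is_subalg A A"
  unfolding is_subalg_def is_semiring_def by blast

text \<open>Operations of an \<open>alg\<close> are arbitrary off the carrier, so the inverse of
  \<open>f\<close> recovers a sum or product from its image only if that value lies in the carrier;
  hence the closure hypothesis.\<close>

lemma isomorphic_sym:
  assumes "is_subalg A A" "isomorphic A B"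
  shows "isomorphic B A"
proof -
  obtain f where f: "is_epi f A B" "inj_on f (carrier A)"
    using assms unfolding isomorphic_def by blast
  let ?g = "inv_into (carrier A) f"
  have B: "carrier B = f ` carrier A" using f by (simp add: is_epi_def)
  have g: "?g (f x) = x" if "x \<in> carrier A" for x
    using that f by simp
  have "is_epi ?g B A"
    unfolding is_epi_def
  proof (intro conjI ballI)
    show "?g ` carrier B = carrier A" using B g by force
  next
    fix x y assume "x \<in> carrier B" "y \<in> carrier B"
    then obtain u v where uv: "u \<in> carrier A" "v \<in> carrier A" "x = f u" "y = f v"
      using B by blast
    then have "plus_of A u v \<in> carrier A" "times_of A u v \<in> carrier A"
      using assms(1) unfolding is_subalg_def by blast+
    moreover have "plus_of B x y = f (plus_of A u v)" "times_of B x y = f (times_of A u v)"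
      using uv f unfolding is_epi_def by auto
    ultimately show "?g (plus_of B x y) = plus_of A (?g x) (?g y)"
      "?g (times_of B x y) = times_of A (?g x) (?g y)"
      using uv g by auto
  qed
  moreover have "inj_on ?g (carrier B)" using B by (simp add: inj_on_inv_into)
  ultimately show ?thesis unfolding isomorphic_def by blast
qed

lemma finite_inj_into_infinite:
  assumes "infinite (UNIV :: 'u set)" "finite A"
  obtains f :: "'a \<Rightarrow> 'u" where "inj_on f A"
proof -
  obtain B :: "'u set" where "finite B" "card B = card A"
    using infinite_arbitrarily_large[OF assms(1), of "card A"] by auto
  then show thesis
    using finite_same_card_bij[OF assms(2)] that unfolding bij_betw_def by metis
qed

text \<open>Transport of structure along an injection of the carrier. The generators live in types
  of their own and enter a class over \<open>'u\<close> through such copies.\<close>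

lemma ex_isomorphic_copy:
  assumes "infinite (UNIV :: 'u set)" "finite (carrier A)"
  obtains T :: "'u alg" where "isomorphic A T"
proof -
  obtain f :: "_ \<Rightarrow> 'u" where f: "inj_on f (carrier A)"
    using finite_inj_into_infinite[OF assms] by metis
  let ?g = "inv_into (carrier A) f"
  define T where "T = \<lparr>carrier = f ` carrier A, plus_of = \<lambda>x y. f (plus_of A (?g x) (?g y)),
    times_of = \<lambda>x y. f (times_of A (?g x) (?g y))\<rparr>"
  have "is_epi f A T"
    using f by (simp add: is_epi_def T_def)
  with f show thesis using that unfolding isomorphic_def by blast
qed

section \<open>Membership of finite algebras in varieties\<close>

text \<open>Closure under epimorphisms concerns algebras over \<open>'u\<close>, while
  \<open>S\<close> and \<open>Q\<close> may live elsewhere. With a copy \<open>T0\<close> of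
  \<open>S\<close>, the composite from \<open>T0\<close> via \<open>S\<close> and \<open>Q\<close>
  to \<open>T\<close> has both ends over \<open>'u\<close>.\<close>

lemma variety_epi_copy:
  fixes K :: "'u alg set"
  assumes u: "infinite (UNIV :: 'u set)" and K: "is_variety K"
    and S: "\<And>T. isomorphic S T \<Longrightarrow> T \<in> K" "finite (carrier S)" "is_subalg S S"
    and f: "is_epi f S Q" and T: "isomorphic Q T"
  shows "T \<in> K"
proof -
  obtain T0 :: "'u alg" where T0: "isomorphic S T0"
    using ex_isomorphic_copy[OF u S(2)] by blast
  obtain g where g: "is_epi g T0 S"
    using isomorphic_sym[OF S(3) T0] unfolding isomorphic_def by blast
  obtain h where h: "is_epi h Q T"
    using T unfolding isomorphic_def by blast
  have "is_epi (h \<circ> (f \<circ> g)) T0 T" by (rule is_epi_comp[OF is_epi_comp[OF g f] h])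
  with S(1)[OF T0] K show ?thesis unfolding is_variety_def by blast
qed

lemma is_variety_subprod:
  fixes I :: "'u set" and B :: "'u alg"
  assumes "is_variety K" "\<And>i. i \<in> I \<Longrightarrow> A i \<in> K" "is_subalg P (prod_alg I A)" "isomorphic P B"
  shows "B \<in> K"
proof -
  have "\<forall>(I :: 'u set) A P B.
      (\<forall>i\<in>I. A i \<in> K) \<and> is_subalg P (prod_alg I A) \<and> isomorphic P B \<longrightarrow> B \<in> K"
    using assms(1) unfolding is_variety_def by (elim conjE)
  from this[THEN spec[of _ I], THEN spec[of _ A], THEN spec[of _ P], THEN spec[of _ B]] assms(2-4)
  show ?thesis by simp
qed

text \<open>Factors and index set both have to move into \<open>'u\<close>: \<open>T0\<close>
  replaces \<open>S\<close>, and \<open>e\<close> embeds \<open>I\<close>. Closure under subalgebras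
  of products then applies to the image \<open>P'\<close> of \<open>P\<close>.\<close>

lemma variety_subpower_copy:
  fixes K :: "'u alg set" and I :: "'i set"
  assumes u: "infinite (UNIV :: 'u set)" and K: "is_variety K"
    and S: "\<And>T. isomorphic S T \<Longrightarrow> T \<in> K" "finite (carrier S)"
    and I: "finite I" and P: "is_subalg P (prod_alg I (\<lambda>_. S))" and B: "isomorphic P B"
  shows "B \<in> K"
proof -
  obtain T0 :: "'u alg" where T0: "isomorphic S T0"
    using ex_isomorphic_copy[OF u S(2)] by blast
  then obtain h where h: "is_epi h S T0" "inj_on h (carrier S)"
    unfolding isomorphic_def by blast
  obtain e :: "'i \<Rightarrow> 'u" where e: "inj_on e I"
    using finite_inj_into_infinite[OF u I] by metis
  define d where "d = inv_into I e"
  have d: "d (e i) = i" if "i \<in> I" for i using e that by (simp add: d_def)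
  let ?J = "e ` I"
  let ?Q = "prod_alg ?J (\<lambda>_. T0)"
  \<comment> \<open>Re-indexing by \<open>d\<close>, with \<open>h\<close> applied in each
    coordinate; the restriction makes the vectors extensional, as membership in \<open>PiE\<close>
    demands.\<close>
  define \<phi> where "\<phi> x = (\<lambda>j\<in>?J. h (x (d j)))" for x
  define P' where "P' = \<lparr>carrier = \<phi> ` carrier P, plus_of = plus_of ?Q, times_of = times_of ?Q\<rparr>"
  have mem: "x \<in> I \<rightarrow>\<^sub>E carrier S" if "x \<in> carrier P" for x
    using P that unfolding is_subalg_def by (auto simp: prod_alg_def)
  have closed: "plus_of P x y \<in> carrier P" "times_of P x y \<in> carrier P"
    if "x \<in> carrier P" "y \<in> carrier P" for x y
    using P that unfolding is_subalg_def by blast+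
  have hom: "\<phi> (plus_of P x y) = plus_of ?Q (\<phi> x) (\<phi> y)"
    "\<phi> (times_of P x y) = times_of ?Q (\<phi> x) (\<phi> y)"
    if xy: "x \<in> carrier P" "y \<in> carrier P" for x y
  proof -
    have P_op: "plus_of P x y = plus_of (prod_alg I (\<lambda>_. S)) x y"
      "times_of P x y = times_of (prod_alg I (\<lambda>_. S)) x y"
      using P xy unfolding is_subalg_def by blast+
    have h': "h (plus_of S (x i) (y i)) = plus_of T0 (h (x i)) (h (y i))"
      "h (times_of S (x i) (y i)) = times_of T0 (h (x i)) (h (y i))" if "i \<in> I" for i
      using h(1) PiE_mem[OF mem[OF xy(1)] that] PiE_mem[OF mem[OF xy(2)] that]
      unfolding is_epi_def by blast+
    show "\<phi> (plus_of P x y) = plus_of ?Q (\<phi> x) (\<phi> y)"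
      "\<phi> (times_of P x y) = times_of ?Q (\<phi> x) (\<phi> y)"
      unfolding P_op by (auto simp: \<phi>_def prod_alg_def d h' fun_eq_iff)
  qed
  have "\<phi> x \<in> carrier ?Q" if "x \<in> carrier P" for x
  proof -
    have "h (x i) \<in> carrier T0" if "i \<in> I" for i
      using h(1) PiE_mem[OF mem[OF \<open>x \<in> carrier P\<close>] that] unfolding is_epi_def by blast
    then show ?thesis by (auto simp: \<phi>_def prod_alg_def d)
  qed
  then have "is_subalg P' ?Q"
    using P closed hom unfolding is_subalg_def P'_def by (auto simp: hom[symmetric])
  moreover have "isomorphic P P'"
  proof -
    have "inj_on \<phi> (carrier P)"
    proof (rule inj_onI)
      fix x y assume xy: "x \<in> carrier P" "y \<in> carrier P" "\<phi> x = \<phi> y"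
      show "x = y"
      proof (rule PiE_ext[OF mem[OF xy(1)] mem[OF xy(2)]])
        fix i assume i: "i \<in> I"
        have "\<phi> x (e i) = \<phi> y (e i)" using xy by simp
        then have "h (x i) = h (y i)" using i by (simp add: \<phi>_def d)
        then show "x i = y i"
          using h(2) i mem[OF xy(1)] mem[OF xy(2)] by (meson PiE_mem inj_onD)
      qed
    qed
    moreover have "is_epi \<phi> P P'" using hom by (simp add: is_epi_def P'_def)
    ultimately show ?thesis unfolding isomorphic_def by blast
  qed
  then have "isomorphic P' B"
    using isomorphic_sym[OF is_subalg_self[OF P]] isomorphic_trans B by blast
  ultimately show ?thesis
    using is_variety_subprod[OF K, of ?J "\<lambda>_. T0"] S(1)[OF T0] by simp
qed

section \<open>Generated varieties\<close>

lemma copy_in_V: "isomorphic S T \<Longrightarrow> T \<in> V S"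
  unfolding V_def by blast

lemma V_subset:
  assumes "is_variety K" "\<And>T. isomorphic Q T \<Longrightarrow> T \<in> K"
  shows "V Q \<subseteq> K"
  unfolding V_def by (intro Inter_lower CollectI conjI allI impI assms)

section \<open>Nilpotency\<close>

text \<open>Bracketing is to the left; in a semiring, associativity makes these all the products of
  that many elements.\<close>

fun products :: "'a alg \<Rightarrow> nat \<Rightarrow> 'a set" where
  "products A 0 = carrier A"
| "products A (Suc k) = {times_of A x y | x y. x \<in> products A k \<and> y \<in> carrier A}"

text \<open>Indices are shifted: \<^term>\<open>products A k\<close> consists of the products of \<open>k + 1\<close> elements.\<close>

definition nilpotent :: "nat \<Rightarrow> 'a alg \<Rightarrow> bool" where
  "nilpotent k A \<longleftrightarrow> (\<forall>x\<in>products A k. \<forall>y\<in>products A k. x = y)"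

lemma products_subset_carrier: "is_subalg A A \<Longrightarrow> products A k \<subseteq> carrier A"
  by (induction k) (auto simp: is_subalg_def)

lemma products_subalg: "is_subalg B A \<Longrightarrow> products B k \<subseteq> products A k"
proof (induction k)
  case (Suc k)
  show ?case
  proof
    fix z assume "z \<in> products B (Suc k)"
    then obtain x y where xy: "z = times_of B x y" "x \<in> products B k" "y \<in> carrier B" by auto
    \<comment> \<open>The operations of \<open>B\<close> and \<open>A\<close> are known to agree
      only on the carrier of \<open>B\<close>.\<close>
    then have "x \<in> carrier B"
      using products_subset_carrier[OF is_subalg_self[OF Suc.prems]] by blast
    then have "z = times_of A x y" "x \<in> products A k" "y \<in> carrier A"
      using xy Suc unfolding is_subalg_def by blast+
    then show "z \<in> products A (Suc k)" by auto
  qed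
qed (auto simp: is_subalg_def)

text \<open>Surjectivity lifts the factors of a product in \<open>B\<close> to \<open>A\<close>;
  this inclusion is the one that carries nilpotency over to images.\<close>

lemma products_epi:
  assumes "is_subalg A A" "is_epi f A B"
  shows "products B k = f ` products A k"
proof (induction k)
  case 0
  then show ?case using assms by (simp add: is_epi_def)
next
  case (Suc k)
  have f: "f (times_of A x y) = times_of B (f x) (f y)"
    if "x \<in> products A k" "y \<in> carrier A" for x y
    using that products_subset_carrier[OF assms(1)] assms(2) unfolding is_epi_def by blast
  have B: "carrier B = f ` carrier A" using assms by (simp add: is_epi_def)
  show ?case
  proof (intro equalityI subsetI)
    fix z assume "z \<in> products B (Suc k)"
    then obtain x y where "x \<in> products A k" "y \<in> carrier A" "z = times_of B (f x) (f y)"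
      using Suc B by auto
    then show "z \<in> f ` products A (Suc k)" using f by force
  next
    fix z assume "z \<in> f ` products A (Suc k)"
    then show "z \<in> products B (Suc k)" using f Suc B by auto
  qed
qed

lemma products_prod:
  "x \<in> products (prod_alg I A) k \<Longrightarrow> i \<in> I \<Longrightarrow> x i \<in> products (A i) k"
proof (induction k arbitrary: x)
  case 0
  then show ?case by (auto simp: prod_alg_def)
next
  case (Suc k)
  then obtain y z where yz: "x = times_of (prod_alg I A) y z" "y \<in> products (prod_alg I A) k"
    "z \<in> carrier (prod_alg I A)" by auto
  then have "y i \<in> products (A i) k" "z i \<in> carrier (A i)"
    using Suc by (auto simp: prod_alg_def)
  then show ?case using yz(1) Suc.prems by (auto simp: prod_alg_def)
qed

lemma nilpotent_epi: "is_subalg A A \<Longrightarrow> is_epi f A B \<Longrightarrow> nilpotent k A \<Longrightarrow> nilpotent k B"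
  by (auto simp: nilpotent_def products_epi)

lemma nilpotent_subalg: "is_subalg B A \<Longrightarrow> nilpotent k A \<Longrightarrow> nilpotent k B"
  using products_subalg unfolding nilpotent_def by blast

lemma nilpotent_prod:
  assumes "is_semiring (prod_alg I A)" "\<And>i. i \<in> I \<Longrightarrow> nilpotent k (A i)"
  shows "nilpotent k (prod_alg I A)"
  unfolding nilpotent_def
proof (intro ballI)
  let ?P = "prod_alg I A"
  fix x y assume xy: "x \<in> products ?P k" "y \<in> products ?P k"
  \<comment> \<open>Membership in the carrier supplies extensionality, so that agreement on
    \<open>I\<close> yields equality.\<close>
  moreover have "products ?P k \<subseteq> carrier ?P"
    using products_subset_carrier[OF is_semiring_imp_is_subalg_self[OF assms(1)]] .
  ultimately have "x \<in> PiE I (\<lambda>i. carrier (A i))" "y \<in> PiE I (\<lambda>i. carrier (A i))"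
    by (auto simp: prod_alg_def)
  moreover have "x i = y i" if "i \<in> I" for i
    using assms(2)[OF that] products_prod[OF xy(1) that] products_prod[OF xy(2) that]
    unfolding nilpotent_def by blast
  ultimately show "x = y" by (rule PiE_ext)
qed

text \<open>\<open>nilpotent k\<close> is the identity x_0 ... x_k = y_0 ... y_k, free of a zero
  because the signature has no constants. Like every identity it passes to subalgebras, epimorphic
  images and products.\<close>

lemma is_variety_nilpotent: "is_variety {A :: 'a alg. is_semiring A \<and> nilpotent k A}"
  unfolding is_variety_def
proof (intro conjI ballI allI impI)
  fix I :: "'a set" and A and P :: "('a \<Rightarrow> 'a) alg" and B :: "'a alg"
  assume *: "(\<forall>i\<in>I. A i \<in> {A. is_semiring A \<and> nilpotent k A}) \<and>
    is_subalg P (prod_alg I A) \<and> isomorphic P B"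
  then have prod: "is_semiring (prod_alg I A)" by (auto intro: is_semiring_prod)
  with * have P: "is_semiring P" "nilpotent k P"
    by (auto intro: is_semiring_subalg intro!: nilpotent_subalg[of P "prod_alg I A"] nilpotent_prod)
  with * show "B \<in> {A. is_semiring A \<and> nilpotent k A}"
    by (auto simp: isomorphic_def intro: is_semiring_epi nilpotent_epi is_semiring_imp_is_subalg_self)
qed (auto intro: is_semiring_epi is_semiring_subalg nilpotent_subalg nilpotent_epi
    is_semiring_imp_is_subalg_self)

section \<open>Word semirings\<close>

lemma finite_carrier_word_semiring: "finite (carrier (word_semiring w))"
proof -
  have "{u. u \<noteq> [] \<and> sublist u w} \<subseteq> set (sublists w)" by auto
  then show ?thesis
    by (simp add: word_semiring_def finite_subset)
qed

lemma is_subalg_word_semiring: "is_subalg (word_semiring w) (word_semiring w)"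
  by (intro is_semiring_imp_is_subalg_self is_semiring_word_semiring)

section \<open>Nilpotency of word semirings\<close>

lemma word_mult_Some_iff:
  "word_mult w x y = Some u \<longleftrightarrow> (\<exists>a b. x = Some a \<and> y = Some b \<and> u = a @ b \<and> sublist u w)"
  by (cases x; cases y) auto

text \<open>A nonzero product concatenates its factors, and the carrier omits the empty word, so
  each of the \<open>k + 1\<close> factors contributes a letter.\<close>

lemma products_word_semiring_length:
  "Some u \<in> products (word_semiring w) k \<Longrightarrow> k < length u \<and> sublist u w"
proof (induction k arbitrary: u)
  case (Suc k)
  then obtain x y where xy: "Some u = times_of (word_semiring w) x y"
    "x \<in> products (word_semiring w) k" "y \<in> carrier (word_semiring w)"
    unfolding products.simps by blast
  then have "word_mult w x y = Some u" by (simp add: word_semiring_def)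
  then obtain a b where "x = Some a" "y = Some b" "u = a @ b" "sublist u w"
    unfolding word_mult_Some_iff by blast
  moreover from this have "b \<noteq> []" using xy(3) by (auto simp: word_semiring_def)
  ultimately show ?case using Suc.IH[of a] xy(2) by (cases b) auto
qed (auto simp: word_semiring_def)

lemma nilpotent_word_semiring: "nilpotent (length w) (word_semiring w)"
proof -
  have "x = None" if x: "x \<in> products (word_semiring w) (length w)" for x
  proof (rule ccontr)
    assume "x \<noteq> None"
    then obtain u where "Some u \<in> products (word_semiring w) (length w)"
      using x by (metis not_None_eq)
    then have "length w < length u \<and> sublist u w" by (rule products_word_semiring_length)
    then show False using sublist_length_le[of u w] by simp
  qed
  then show ?thesis unfolding nilpotent_def by metis
qed

lemma None_in_products: "None \<in> products (word_semiring w) k"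
proof (induction k)
  case (Suc k)
  have "None = times_of (word_semiring w) None None" by (simp add: word_semiring_def)
  moreover have "None \<in> carrier (word_semiring w)" by (simp add: word_semiring_def)
  ultimately show ?case using Suc unfolding products.simps by blast
qed (simp add: word_semiring_def)

text \<open>Multiply the first \<open>k + 1\<close> letters one at a time. This nonzero product,
  next to \<open>None\<close>, refutes nilpotency.\<close>

lemma prefix_in_products:
  "k < length w \<Longrightarrow> Some (take (Suc k) w) \<in> products (word_semiring w) k"
proof (induction k)
  case 0
  then show ?case by (auto simp: word_semiring_def intro: sublist_take)
next
  case (Suc k)
  have "take (Suc (Suc k)) w = take (Suc k) w @ [w ! Suc k]"
    using Suc.prems by (rule take_Suc_conv_app_nth)
  then have "Some (take (Suc (Suc k)) w)
      = times_of (word_semiring w) (Some (take (Suc k) w)) (Some [w ! Suc k])"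
    using sublist_take[of "Suc (Suc k)" w] by (simp add: word_semiring_def)
  moreover have "sublist [w ! Suc k] w"
    using id_take_nth_drop[OF Suc.prems] unfolding sublist_def by (metis append_Cons append_Nil)
  then have "Some [w ! Suc k] \<in> carrier (word_semiring w)" by (simp add: word_semiring_def)
  ultimately show ?case using Suc unfolding products.simps by auto
qed

lemma not_nilpotent_word_semiring:
  assumes "k < length w"
  shows "\<not> nilpotent k (word_semiring w)"
  using prefix_in_products[OF assms] None_in_products[of w k] unfolding nilpotent_def by blast

text \<open>A Rees quotient: factors of subwords of \<open>w\<close> are subwords of
  \<open>w\<close>, so the remaining words form an ideal together with zero. Flat addition is
  respected because only elements sent to zero are identified.\<close>

lemma is_epi_word_semiring_sublist:
  assumes "sublist w w'"
  shows "is_epi (\<lambda>x. case x of None \<Rightarrow> None | Some u \<Rightarrow> if sublist u w then Some u else None)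
    (word_semiring w') (word_semiring w)"
proof -
  have trans: "sublist u w'" if "sublist u w" for u
    using that assms sublist_order.order_trans by blast
  have lr: "sublist u w" "sublist v w" if "sublist (u @ v) w" for u v
    using that unfolding sublist_def by (metis append_assoc)+
  let ?f = "\<lambda>x. case x of None \<Rightarrow> None | Some u \<Rightarrow> if sublist u w then Some u else None"
  have subset: "?f ` carrier (word_semiring w') \<subseteq> carrier (word_semiring w)"
    by (auto simp: word_semiring_def split: option.splits)
  have supset: "carrier (word_semiring w) \<subseteq> ?f ` carrier (word_semiring w')"
  proof
    fix x assume "x \<in> carrier (word_semiring w)"
    then have "x = ?f x" "x \<in> carrier (word_semiring w')"
      by (auto simp: word_semiring_def trans)
    then show "x \<in> ?f ` carrier (word_semiring w')" by (rule image_eqI)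
  qed
  have plus: "?f (flat_add None x y) = flat_add None (?f x) (?f y)" for x y
    by (cases x; cases y) (auto simp: flat_add_def)
  have times: "?f (word_mult w' x y) = word_mult w (?f x) (?f y)" for x y
    by (cases x; cases y) (auto simp: trans dest: lr)
  show ?thesis
    unfolding is_epi_def using plus times
    by (intro conjI equalityI[OF subset supset]) (simp_all add: word_semiring_def)
qed

lemma V_word_semiring_strict_mono:
  fixes w w' :: "'a list"
  assumes u: "infinite (UNIV :: 'u set)" and w: "sublist w w'" "length w < length w'"
  shows "(V (word_semiring w) :: 'u alg set) \<subset> V (word_semiring w')"
proof
  show "(V (word_semiring w) :: 'u alg set) \<subseteq> V (word_semiring w')"
  proof (rule V_subset)
    show V: "is_variety (V (word_semiring w') :: 'u alg set)"
      by (rule is_variety_V[OF is_semiring_word_semiring])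
    show "T \<in> V (word_semiring w')" if "isomorphic (word_semiring w) T" for T :: "'u alg"
      by (rule variety_epi_copy[OF u V copy_in_V finite_carrier_word_semiring
            is_subalg_word_semiring is_epi_word_semiring_sublist[OF w(1)] that])
  qed
  \<comment> \<open>The separating variety: it contains every copy of \<open>word_semiring w\<close>
    and no copy of \<open>word_semiring w'\<close>.\<close>
  let ?K = "{A :: 'u alg. is_semiring A \<and> nilpotent (length w) A}"
  have "V (word_semiring w) \<subseteq> ?K"
  proof (intro V_subset is_variety_nilpotent)
    fix T :: "'u alg" assume "isomorphic (word_semiring w) T"
    then show "T \<in> ?K"
      unfolding isomorphic_def
      by (auto intro: is_semiring_epi[OF is_semiring_word_semiring]
          nilpotent_epi[OF is_subalg_word_semiring] nilpotent_word_semiring)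
  qed
  moreover obtain T :: "'u alg" where T: "isomorphic (word_semiring w') T"
    using ex_isomorphic_copy[OF u finite_carrier_word_semiring] by blast
  have "\<not> nilpotent (length w) T"
  proof
    assume nil: "nilpotent (length w) T"
    \<comment> \<open>Nilpotency travels along epimorphisms, so the isomorphism is reversed to carry
      it from \<open>T\<close> to \<open>word_semiring w'\<close>.\<close>
    have iso: "isomorphic T (word_semiring w')"
      by (rule isomorphic_sym[OF is_subalg_word_semiring T])
    have "is_semiring T"
      using T unfolding isomorphic_def
      by (auto intro: is_semiring_epi[OF is_semiring_word_semiring])
    with iso nil have "nilpotent (length w) (word_semiring w')"
      unfolding isomorphic_def by (auto intro: nilpotent_epi is_semiring_imp_is_subalg_self)
    with not_nilpotent_word_semiring[OF w(2)] show False by blast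
  qed
  ultimately show "(V (word_semiring w) :: 'u alg set) \<noteq> V (word_semiring w')"
    using copy_in_V[OF T] by auto
qed

section \<open>Word semirings as quotients of subpowers of \<open>B0\<close>\<close>

lemma upt_append: "i \<le> j \<Longrightarrow> j \<le> k \<Longrightarrow> [i..<j] @ [j..<k] = [i..<k]"
  using upt_add_eq_append[of i j "k - j"] by simp

lemma sublist_iff_interval:
  "u \<noteq> [] \<and> sublist u w \<longleftrightarrow> (\<exists>j k. j < k \<and> k \<le> length w \<and> u = map ((!) w) [j..<k])"
proof
  assume "u \<noteq> [] \<and> sublist u w"
  then obtain p s where "w = p @ u @ s" "u \<noteq> []" unfolding sublist_def by blast
  then have "u = map ((!) w) [length p..<length p + length u]"
    by (intro nth_equalityI) (auto simp: nth_append)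
  with \<open>w = _\<close> \<open>u \<noteq> []\<close> show "\<exists>j k. j < k \<and> k \<le> length w \<and> u = map ((!) w) [j..<k]"
    by (intro exI[of _ "length p"] exI[of _ "length p + length u"]) auto
next
  assume "\<exists>j k. j < k \<and> k \<le> length w \<and> u = map ((!) w) [j..<k]"
  then obtain j k where jk: "j < k" "k \<le> length w" "u = map ((!) w) [j..<k]" by blast
  then have "u = take (k - j) (drop j w)"
    by (intro nth_equalityI) auto
  then show "u \<noteq> [] \<and> sublist u w"
    using jk by (auto intro: sublist_order.order_trans sublist_take sublist_drop)
qed

text \<open>Distinct letters turn equality of words into equality of position lists, and two runs of
  consecutive numbers form one run only if they abut. For the word aa and the interval [0, 1) taken
  twice this fails.\<close>

lemma sublist_intervals_append_iff:
  assumes "distinct w" "j < k" "k \<le> length w" "l < m" "m \<le> length w"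
  shows "sublist (map ((!) w) [j..<k] @ map ((!) w) [l..<m]) w \<longleftrightarrow> k = l"
proof
  assume "k = l"
  then have "map ((!) w) [j..<k] @ map ((!) w) [l..<m] = map ((!) w) [j..<m]"
    using assms upt_append[of j k m] by (simp flip: map_append)
  then show "sublist (map ((!) w) [j..<k] @ map ((!) w) [l..<m]) w"
    using sublist_iff_interval[of "map ((!) w) [j..<m]" w] assms \<open>k = l\<close>
    by (metis order.strict_trans)
next
  assume "sublist (map ((!) w) [j..<k] @ map ((!) w) [l..<m]) w"
  then obtain a b where ab: "b \<le> length w"
    "map ((!) w) ([j..<k] @ [l..<m]) = map ((!) w) [a..<b]"
    using sublist_iff_interval[of "map ((!) w) [j..<k] @ map ((!) w) [l..<m]" w] assms by auto
  have "inj_on ((!) w) {..<length w}" using assms(1) by (simp add: inj_on_nth)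
  then have eq: "[j..<k] @ [l..<m] = [a..<b]"
    using ab assms by (subst (asm) inj_on_map_eq_map) (auto elim: inj_on_subset)
  have len: "(k - j) + (m - l) = b - a" using arg_cong[OF eq, of length] by simp
  \<comment> \<open>Entry 0 gives \<open>j = a\<close>; entry \<open>k - j\<close>, where the second
    run begins, gives \<open>l = a + (k - j)\<close>.\<close>
  have "([j..<k] @ [l..<m]) ! 0 = [a..<b] ! 0" using eq by simp
  then have "j = a" using assms len by (simp add: nth_append)
  moreover have "([j..<k] @ [l..<m]) ! (k - j) = [a..<b] ! (k - j)" using eq by simp
  then have "l = a + (k - j)" using assms len by (simp add: nth_append)
  ultimately show "k = l" using assms by simp
qed

text \<open>Positions count from 0 and \<open>k\<close> is excluded. Coordinate \<open>i\<close>
  tracks the reading of letter \<open>i\<close>, with state 1 before it and state 2 after it: a word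
  to its right is the loop e22, a word containing it the arrow e12, a word to its left the loop
  e11.\<close>

definition interval_vector :: "nat \<Rightarrow> nat \<Rightarrow> nat \<Rightarrow> nat \<Rightarrow> int ^ 2 ^ 2" where
  "interval_vector n j k = (\<lambda>i\<in>{..<n}.
     if i < j then matrix_unit 2 2 else if i < k then matrix_unit 1 2 else matrix_unit 1 1)"

text \<open>A sum or product of interval vectors may vanish in some coordinates only, so one zero
  entry has to suffice.\<close>

definition zero_vectors :: "nat \<Rightarrow> (nat \<Rightarrow> int ^ 2 ^ 2) set" where
  "zero_vectors n = {x \<in> {..<n} \<rightarrow>\<^sub>E carrier B0. \<exists>i<n. x i = 0}"

definition interval_subpower :: "nat \<Rightarrow> (nat \<Rightarrow> int ^ 2 ^ 2) alg" where
  "interval_subpower n =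
     (prod_alg {..<n} (\<lambda>_. B0))
       \<lparr>carrier := zero_vectors n \<union> {interval_vector n j k | j k. j < k \<and> k \<le> n}\<rparr>"

definition vector_word :: "'a list \<Rightarrow> (nat \<Rightarrow> int ^ 2 ^ 2) \<Rightarrow> 'a list option" where
  "vector_word w x =
     (if \<exists>i<length w. x i = 0 then None
      else Some (map ((!) w) (filter (\<lambda>i. x i = matrix_unit 1 2) [0..<length w])))"

section \<open>Operations on vectors over \<open>B0\<close>\<close>

lemma carrier_prod_B0: "carrier (prod_alg {..<n} (\<lambda>_. B0)) = {..<n} \<rightarrow>\<^sub>E carrier B0"
  by (simp add: prod_alg_def)

lemma interval_vector_nonzero: "i < n \<Longrightarrow> interval_vector n j k i \<noteq> 0"
  by (simp add: interval_vector_def)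

lemma interval_vector_mem: "interval_vector n j k \<in> {..<n} \<rightarrow>\<^sub>E carrier B0"
  by (auto simp: interval_vector_def B0_def)

lemma subpower_plus_self:
  assumes "x \<in> {..<n} \<rightarrow>\<^sub>E carrier B0"
  shows "plus_of (prod_alg {..<n} (\<lambda>_. B0)) x x = x"
  using PiE_restrict[OF assms] by (simp add: prod_alg_def B0_def flat_add_def)

text \<open>Distinct extensional vectors differ at some index below \<open>n\<close>, and flat
  addition is 0 there.\<close>

lemma subpower_plus_neq:
  assumes "x \<in> {..<n} \<rightarrow>\<^sub>E carrier B0" "y \<in> {..<n} \<rightarrow>\<^sub>E carrier B0" "x \<noteq> y"
  shows "plus_of (prod_alg {..<n} (\<lambda>_. B0)) x y \<in> zero_vectors n"
proof -
  let ?P = "prod_alg {..<n} (\<lambda>_. B0)"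
  have "is_semiring ?P" by (intro is_semiring_prod is_semiring_B0)
  then have "plus_of ?P x y \<in> carrier ?P"
    using assms by (intro is_semiringD(2)) (simp_all add: carrier_prod_B0)
  moreover obtain i where "i < n" "x i \<noteq> y i" using assms PiE_ext by blast
  then have "plus_of ?P x y i = 0" by (simp add: prod_alg_def B0_def flat_add_def)
  ultimately show ?thesis
    using \<open>i < n\<close> unfolding zero_vectors_def by (auto simp: carrier_prod_B0)
qed

lemma subpower_times_eq_0:
  assumes "x \<in> {..<n} \<rightarrow>\<^sub>E carrier B0" "y \<in> {..<n} \<rightarrow>\<^sub>E carrier B0" "i < n" "x i ** y i = 0"
  shows "times_of (prod_alg {..<n} (\<lambda>_. B0)) x y \<in> zero_vectors n"
proof -
  let ?P = "prod_alg {..<n} (\<lambda>_. B0)"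
  have "is_semiring ?P" by (intro is_semiring_prod is_semiring_B0)
  then have "times_of ?P x y \<in> carrier ?P"
    using assms by (intro is_semiringD(3)) (simp_all add: carrier_prod_B0)
  moreover have "times_of ?P x y i = 0" using assms by (simp add: prod_alg_def B0_def)
  ultimately show ?thesis
    using \<open>i < n\<close> unfolding zero_vectors_def by (auto simp: carrier_prod_B0)
qed

text \<open>\<open>zero_vectors\<close> is an ideal, which is what allows it to be
  collapsed.\<close>

lemma subpower_times_zero_vector:
  assumes "x \<in> {..<n} \<rightarrow>\<^sub>E carrier B0" "y \<in> {..<n} \<rightarrow>\<^sub>E carrier B0"
    "x \<in> zero_vectors n \<or> y \<in> zero_vectors n"
  shows "times_of (prod_alg {..<n} (\<lambda>_. B0)) x y \<in> zero_vectors n"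
proof -
  obtain i where "i < n" "x i = 0 \<or> y i = 0" using assms(3) unfolding zero_vectors_def by blast
  then show ?thesis using subpower_times_eq_0[OF assms(1,2), of i] by auto
qed

text \<open>From left to right the coordinates give e22 e22 = e22, e12 e22 = e12, e11 e12 = e12 and
  e11 e11 = e11.\<close>

lemma interval_vector_times:
  assumes "j < k" "k < m"
  shows "times_of (prod_alg {..<n} (\<lambda>_. B0)) (interval_vector n j k) (interval_vector n k m)
    = interval_vector n j m"
  using assms
  by (auto simp: prod_alg_def B0_def interval_vector_def matrix_unit_mult fun_eq_iff)

lemma interval_vector_times_neq:
  assumes "j < k" "k \<le> n" "l < m" "m \<le> n" "k \<noteq> l"
  shows "times_of (prod_alg {..<n} (\<lambda>_. B0)) (interval_vector n j k) (interval_vector n l m)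
    \<in> zero_vectors n"
proof (rule subpower_times_eq_0)
  \<comment> \<open>If \<open>l < k\<close>, then e12 or e22 meets e12 at \<open>l\<close>; if \<open>k < l\<close>, then e11 meets e22 at \<open>k\<close>.\<close>
  let ?i = "if l < k then l else k"
  show "?i < n" using assms by auto
  show "interval_vector n j k ?i ** interval_vector n l m ?i = 0"
    using assms by (auto simp: interval_vector_def matrix_unit_mult)
qed (rule interval_vector_mem)+

section \<open>The subalgebra of interval vectors and zero vectors\<close>

lemma interval_subpower_cases:
  assumes "x \<in> carrier (interval_subpower n)"
  obtains "x \<in> zero_vectors n"
    | j k where "j < k" "k \<le> n" "x = interval_vector n j k"
  using assms unfolding interval_subpower_def by auto

lemma interval_subpower_mem:
  "x \<in> carrier (interval_subpower n) \<Longrightarrow> x \<in> {..<n} \<rightarrow>\<^sub>E carrier B0"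
  by (erule interval_subpower_cases) (auto simp: zero_vectors_def interval_vector_mem)

lemma interval_subpower_ops [simp]:
  "plus_of (interval_subpower n) = plus_of (prod_alg {..<n} (\<lambda>_. B0))"
  "times_of (interval_subpower n) = times_of (prod_alg {..<n} (\<lambda>_. B0))"
  by (simp_all add: interval_subpower_def)

lemma zero_vectors_subset: "zero_vectors n \<subseteq> carrier (interval_subpower n)"
  by (simp add: interval_subpower_def)

lemma interval_vector_in_subpower:
  "j < k \<Longrightarrow> k \<le> n \<Longrightarrow> interval_vector n j k \<in> carrier (interval_subpower n)"
  by (auto simp: interval_subpower_def)

text \<open>For \<open>n = 0\<close> the carrier would be empty. Sums and products that are not
  interval vectors acquire a zero entry and so remain inside.\<close>

lemma is_subalg_interval_subpower:
  assumes "0 < n"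
  shows "is_subalg (interval_subpower n) (prod_alg {..<n} (\<lambda>_. B0))"
proof -
  let ?S = "carrier (interval_subpower n)"
  have "?S \<noteq> {}" using interval_vector_in_subpower[of 0 n n] assms by blast
  moreover have "?S \<subseteq> carrier (prod_alg {..<n} (\<lambda>_. B0))"
    using interval_subpower_mem by (auto simp: carrier_prod_B0)
  moreover have "plus_of (prod_alg {..<n} (\<lambda>_. B0)) x y \<in> ?S" if "x \<in> ?S" "y \<in> ?S" for x y
    using that subpower_plus_self[of x n] subpower_plus_neq[of x n y] zero_vectors_subset[of n]
      interval_subpower_mem[of x n] interval_subpower_mem[of y n]
    by (metis subsetD)
  moreover have "times_of (prod_alg {..<n} (\<lambda>_. B0)) x y \<in> ?S" if x: "x \<in> ?S" and y: "y \<in> ?S" for x y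
  proof (cases "x \<in> zero_vectors n \<or> y \<in> zero_vectors n")
    case True
    then show ?thesis
      using subpower_times_zero_vector[OF interval_subpower_mem[OF x] interval_subpower_mem[OF y]]
        zero_vectors_subset by blast
  next
    case False
    then obtain j k l m where jk: "j < k" "k \<le> n" "x = interval_vector n j k"
      and lm: "l < m" "m \<le> n" "y = interval_vector n l m"
      using x y interval_subpower_cases by metis
    show ?thesis
    proof (cases "k = l")
      case True
      then show ?thesis
        using jk lm interval_vector_times[of j k m n] by (simp add: interval_vector_in_subpower)
    next
      case False
      then show ?thesis using jk lm interval_vector_times_neq zero_vectors_subset by blast
    qed
  qed
  ultimately show ?thesis unfolding is_subalg_def by simp
qed

section \<open>The quotient map onto the word semiring\<close>

lemma vector_word_zero: "x \<in> zero_vectors (length w) \<Longrightarrow> vector_word w x = None"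
  by (auto simp: vector_word_def zero_vectors_def)

lemma vector_word_interval:
  assumes "j < k" "k \<le> length w"
  shows "vector_word w (interval_vector (length w) j k) = Some (map ((!) w) [j..<k])"
proof -
  let ?P = "\<lambda>i. interval_vector (length w) j k i = matrix_unit 1 2"
  have "[0..<length w] = [0..<j] @ [j..<k] @ [k..<length w]"
    using assms by (simp add: upt_append)
  moreover have "filter ?P [0..<j] = []" "filter ?P [j..<k] = [j..<k]" "filter ?P [k..<length w] = []"
    using assms by (auto simp: filter_empty_conv filter_id_conv interval_vector_def)
  ultimately have "filter ?P [0..<length w] = [j..<k]" by simp
  then show ?thesis by (simp add: vector_word_def interval_vector_nonzero)
qed

text \<open>The map collapses the ideal of zero vectors and, the letters being distinct, is
  injective on interval vectors.\<close>

lemma is_epi_vector_word: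
  assumes w: "distinct w" "w \<noteq> []"
  shows "is_epi (vector_word w) (interval_subpower (length w)) (word_semiring w)"
proof -
  let ?n = "length w"
  let ?S = "carrier (interval_subpower ?n)" and ?Q = "prod_alg {..<?n} (\<lambda>_. B0)"
  have inj: "inj_on ((!) w) {..<?n}" using w by (simp add: inj_on_nth)
  have image: "vector_word w ` ?S = carrier (word_semiring w)"
  proof (intro equalityI subsetI)
    fix y assume "y \<in> vector_word w ` ?S"
    then obtain x where x: "x \<in> ?S" "y = vector_word w x" by blast
    show "y \<in> carrier (word_semiring w)"
      using x(1)
    proof (cases rule: interval_subpower_cases)
      case 1
      then show ?thesis using x by (simp add: vector_word_zero word_semiring_def)
    next
      case (2 j k)
      then have "map ((!) w) [j..<k] \<noteq> [] \<and> sublist (map ((!) w) [j..<k]) w"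
        unfolding sublist_iff_interval by blast
      with 2 show ?thesis
        using x by (simp add: vector_word_interval word_semiring_def)
    qed
  next
    fix y assume y: "y \<in> carrier (word_semiring w)"
    show "y \<in> vector_word w ` ?S"
    proof (cases y)
      case None
      \<comment> \<open>A preimage of \<open>None\<close>; it has a zero entry because
        \<open>w\<close> is nonempty.\<close>
      have "(\<lambda>i\<in>{..<?n}. 0) \<in> zero_vectors ?n"
        using w by (auto simp: zero_vectors_def B0_def)
      then show ?thesis
        using None zero_vectors_subset[of ?n] vector_word_zero[of "\<lambda>i\<in>{..<?n}. 0" w] by force
    next
      case (Some u)
      then have "u \<noteq> [] \<and> sublist u w" using y by (auto simp: word_semiring_def)
      then obtain j k where "j < k" "k \<le> ?n" "u = map ((!) w) [j..<k]"
        using sublist_iff_interval by blast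
      then show ?thesis
        using Some vector_word_interval[of j k w] interval_vector_in_subpower[of j k ?n] by force
    qed
  qed
  have plus: "vector_word w (plus_of ?Q x y) = flat_add None (vector_word w x) (vector_word w y)"
    if x: "x \<in> ?S" and y: "y \<in> ?S" for x y
  proof (cases "x = y")
    case True
    then show ?thesis
      using subpower_plus_self[OF interval_subpower_mem[OF x]] by (simp add: flat_add_def)
  next
    case neq: False
    \<comment> \<open>The sum of distinct vectors maps to \<open>None\<close>, and so does the flat
      sum of their images unless these agree in a nonzero value; that case is excluded here.\<close>
    have "vector_word w x = None" if eq: "vector_word w x = vector_word w y"
    proof (cases "x \<in> zero_vectors ?n \<or> y \<in> zero_vectors ?n")
      case True
      then show ?thesis using eq vector_word_zero by metis
    next
      case False
      then obtain j k l m where jk: "j < k" "k \<le> ?n" "x = interval_vector ?n j k"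
        and lm: "l < m" "m \<le> ?n" "y = interval_vector ?n l m"
        using x y interval_subpower_cases by metis
      then have "map ((!) w) [j..<k] = map ((!) w) [l..<m]"
        using eq by (simp add: vector_word_interval)
      then have "[j..<k] = [l..<m]"
        using jk lm inj by (subst (asm) inj_on_map_eq_map) (auto elim: inj_on_subset)
      then have "{j..<k} = {l..<m}" by (metis set_upt)
      then have "j = l" "k = m" using jk lm by (auto simp: atLeastLessThan_eq_iff)
      then show ?thesis using jk lm neq by simp
    qed
    moreover have "vector_word w (plus_of ?Q x y) = None"
      by (intro vector_word_zero subpower_plus_neq interval_subpower_mem x y neq)
    ultimately show ?thesis by (auto simp: flat_add_def)
  qed
  have times: "vector_word w (times_of ?Q x y) = word_mult w (vector_word w x) (vector_word w y)"
    if x: "x \<in> ?S" and y: "y \<in> ?S" for x y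
  proof (cases "x \<in> zero_vectors ?n \<or> y \<in> zero_vectors ?n")
    case True
    then have "vector_word w (times_of ?Q x y) = None"
      by (intro vector_word_zero subpower_times_zero_vector interval_subpower_mem x y)
    moreover have "word_mult w a None = None" for a by (cases a) auto
    ultimately show ?thesis using True by (auto simp: vector_word_zero)
  next
    case False
    then obtain j k l m where jk: "j < k" "k \<le> ?n" "x = interval_vector ?n j k"
      and lm: "l < m" "m \<le> ?n" "y = interval_vector ?n l m"
      using x y interval_subpower_cases by metis
    \<comment> \<open>Adjacency \<open>k = l\<close> decides on both sides whether the product is
      nonzero.\<close>
    have iff: "sublist (map ((!) w) [j..<k] @ map ((!) w) [l..<m]) w \<longleftrightarrow> k = l"
      by (intro sublist_intervals_append_iff w jk lm)
    show ?thesis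
    proof (cases "k = l")
      case True
      then have "map ((!) w) [j..<m] = map ((!) w) [j..<k] @ map ((!) w) [l..<m]"
        using jk lm upt_append[of j k m] by (simp flip: map_append)
      then show ?thesis
        using True jk lm iff by (simp add: interval_vector_times vector_word_interval)
    next
      case False
      then have "vector_word w (times_of ?Q x y) = None"
        using jk lm by (simp add: vector_word_zero interval_vector_times_neq)
      then show ?thesis using False jk lm iff by (simp add: vector_word_interval)
    qed
  qed
  show ?thesis
    unfolding is_epi_def using image plus times by (simp add: word_semiring_def)
qed

lemma V_word_semiring_subset_V_B0:
  fixes w :: "'a list"
  assumes u: "infinite (UNIV :: 'u set)" and w: "distinct w" "w \<noteq> []"
  shows "(V (word_semiring w) :: 'u alg set) \<subseteq> V B0"
proof (rule V_subset)
  show V: "is_variety (V B0 :: 'u alg set)" by (rule is_variety_V[OF is_semiring_B0])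
  let ?P = "interval_subpower (length w)"
  have P: "is_subalg ?P (prod_alg {..<length w} (\<lambda>_. B0))"
    using w by (intro is_subalg_interval_subpower) simp
  have "finite (carrier B0)" by (simp add: B0_def)
  then have fin: "finite ({..<length w} \<rightarrow>\<^sub>E carrier B0)" by (intro finite_PiE) auto
  fix T :: "'u alg" assume T: "isomorphic (word_semiring w) T"
  show "T \<in> V B0"
  \<comment> \<open>Copies of the subpower \<open>?P\<close> lie in \<open>V B0\<close>, and the
    word semiring is an epimorphic image of \<open>?P\<close>.\<close>
  proof (rule variety_epi_copy[OF u V])
    show "T' \<in> V B0" if "isomorphic ?P T'" for T' :: "'u alg"
      using variety_subpower_copy[OF u V copy_in_V \<open>finite (carrier B0)\<close> _ P that] by simp
    show "finite (carrier ?P)"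
      using interval_subpower_mem by (intro finite_subset[OF _ fin]) blast
  qed (fact is_subalg_self[OF P] is_epi_vector_word[OF w] T)+
qed

section \<open>The chain in the subvariety lattice\<close>

lemma V_word_semiring_in_subvarieties_V_B0:
  fixes w :: "'a list"
  assumes "infinite (UNIV :: 'u set)" "distinct w" "w \<noteq> []"
  shows "(V (word_semiring w) :: 'u alg set) \<in> subvarieties (V B0)"
  using V_word_semiring_subset_V_B0[OF assms] is_variety_V[OF is_semiring_word_semiring]
  by (simp add: subvarieties_def)

theorem corollary5p4:
  assumes "infinite (UNIV :: 'u set)"
  shows "infinite (subvarieties (V B0 :: 'u alg set)) \<and>
    (\<forall>a :: nat \<Rightarrow> 'a. inj_on a {1..} \<longrightarrow>
       (\<forall>n\<ge>1.
          (V (word_semiring (map a [1..<n + 1])) :: 'u alg set) \<in> subvarieties (V B0) \<and>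
          (V (word_semiring (map a [1..<n + 1])) :: 'u alg set)
            \<subset> V (word_semiring (map a [1..<n + 2]))))"
proof -
  \<comment> \<open>The type \<open>'a\<close> may be finite and then admits no injective
    \<open>a\<close>, so infinity is witnessed with natural numbers as letters. \<open>Suc n\<close>
    keeps the words nonempty.\<close>
  define F where "F n = (V (word_semiring [0..<Suc n]) :: 'u alg set)" for n
  have "F n \<subset> F (Suc n)" for n
    unfolding F_def
  proof (rule V_word_semiring_strict_mono[OF assms])
    show "sublist [0..<Suc n] [0..<Suc (Suc n)]" by simp
  qed simp
  then have "strict_mono F" by (simp add: strict_mono_Suc_iff)
  then have "infinite (range F)" using range_inj_infinite strict_mono_imp_inj_on by blast
  moreover have "range F \<subseteq> subvarieties (V B0)"
    unfolding F_def
    by (intro image_subsetI V_word_semiring_in_subvarieties_V_B0 assms distinct_upt) simp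
  ultimately have "infinite (subvarieties (V B0 :: 'u alg set))"
    using infinite_super by metis
  moreover have "(V (word_semiring (map a [1..<n + 1])) :: 'u alg set) \<in> subvarieties (V B0) \<and>
      (V (word_semiring (map a [1..<n + 1])) :: 'u alg set)
        \<subset> V (word_semiring (map a [1..<n + 2]))"
    if "inj_on a {1..}" "n \<ge> 1" for a :: "nat \<Rightarrow> 'a" and n
  proof
    show "(V (word_semiring (map a [1..<n + 1])) :: 'u alg set) \<in> subvarieties (V B0)"
    proof (rule V_word_semiring_in_subvarieties_V_B0[OF assms])
      have "inj_on a {1..<n + 1}" using that(1) by (rule inj_on_subset) auto
      then show "distinct (map a [1..<n + 1])"
        by (simp only: distinct_map distinct_upt set_upt simp_thms)
      show "map a [1..<n + 1] \<noteq> []" using that(2) by simp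
    qed
    show "(V (word_semiring (map a [1..<n + 1])) :: 'u alg set)
        \<subset> V (word_semiring (map a [1..<n + 2]))"
    proof (rule V_word_semiring_strict_mono[OF assms])
      \<comment> \<open>The shorter word is a prefix of the longer one.\<close>
      have "[1..<n + 2] = [1..<n + 1] @ [n + 1]" by simp
      then show "sublist (map a [1..<n + 1]) (map a [1..<n + 2])"
        by (simp only: map_append sublist_append_rightI)
    qed simp
  qed
  ultimately show ?thesis by blast
qed

end
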